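(* Let $N$ be the number of bodies, let $m_1,\dots,m_{N-1}>0$, let $a_1,\dots,a_{N}\in\mathbb{R}^2$ be a normalized central configuration of the restricted $N$-body problem (with $m_N=0$) with constant $\mu$, let $0\le e<1$, $p>0$, $\sigma=(\mu p)^{1/4}$ and $r(\theta)=p/(1+e\cos\theta)$. Consider the Hamiltonian $$H(\theta,\bar Z,\bar z)=\frac12|\bar Z|^2+\bar z\cdot J_2\bar Z+\frac{p-r(\theta)}{2p}|\bar z|^2-\frac{r(\theta)}{\sigma}\sum_{i=1}^{N-1}\frac{m_i}{|\sigma a_i-\bar z|},\qquad \bar Z,\bar z\in\mathbb{R}^2 .$$ Then the linearized Hamiltonian system of $H$ at the elliptic relative equilibrium $$\xi_0\equiv(\bar Z(\theta),\bar z(\theta))^T=(0,\sigma,\sigma,0)^T\in\mathbb{R}^4,$$ that is, $\bar Z(\theta)=(0,\sigma)^T$ and $\bar z(\theta)=(\sigma,0)^T$, depending on the true anomaly $\theta$, is given by $$\dot\xi(\theta)=J_4B(\theta)\xi(\theta),\qquad B(\theta)=H''(\theta,\bar Z,\bar z)\big|_{(\bar Z,\bar z)^T=\xi_0}=\begin{pmatrix} I_2&-J_2\\ J_2& I_2-\frac{1}{1+e\cos\theta}D\end{pmatrix},$$ where $$D=I_2-\frac1\mu\left(\sum_{i=1}^{N-1}\frac{m_i}{|a_i-a_N|^3}\right)I_2+\frac3\mu\sum_{i=1}^{N-1}m_i\frac{(a_i-a_N)(a_i-a_N)^T}{|a_i-a_N|^5}.$$ The corresponding quadratic Hamiltonian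 function is $$H_2(\theta,\bar Z,\bar z)=\frac12|\bar Z|^2+\bar z\cdot J_2\bar Z+\frac12\,\bar z^T\left(I_2-\frac{D}{1+e\cos\theta}\right)\bar z .$$
   Context: $I_2$ is the $2\times2$ identity, $J_2=\begin{pmatrix}0&-1\\ 1&0\end{pmatrix}$, $J_4=\begin{pmatrix}0&-I_2\\ I_2&0\end{pmatrix}$. A Hamiltonian system for $(Z,z)$ reads $\dot Z=-\partial H/\partial z$, $\dot z=\partial H/\partial Z$; a dot in the linearized system denotes $d/d\theta$; $H''$ is the Hessian with respect to $(\bar Z,\bar z)$, and vectors are ordered as $\xi=(Z,z)^T$. Normalized central configuration of the restricted $N$-body problem: the points $a_1,\dots,a_N\in\mathbb{R}^2$ are pairwise distinct, $\sum_{i=1}^{N-1}m_i|a_i|^2=1$, $\mu=\sum_{1\le i<j\le N-1}\frac{m_im_j}{|a_i-a_j|}$, and $$\sum_{1\le j\le N-1,\ j\ne i}\frac{m_j(a_j-a_i)}{|a_j-a_i|^3}=-\mu a_i\qquad (1\le i\le N),$$ where for $i=N$ the sum runs over all $1\le j\le N-1$ (the body $N$ is massless). The Hamiltonian $H$ is the reduced Hamiltonian, in the true anomaly $\theta$, of the massless body moving in the field of the $N-1$ primaries located at $r(\theta(t))R(\theta(t))a_i$, where $R(\theta)$ is the rotation by angle $\theta$ and $(r,\theta)$ is a Kepler elliptic orbit of eccentricity $e$ with $r=p/(1+e\cos\theta)$ and $r^2\,d\theta/dt=\sigma^2$. The elliptic relative equilibrium $q(t)=r(t)R(\theta(t))a_N$,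 $P(t)=dq/dt$ of the massless body is written, in the reduced coordinates with independent variable $\theta$, as the constant solution $(\bar Z,\bar z)^T=(0,\sigma,\sigma,0)^T$.
   Formalization: The relative equilibrium is taken as (Z,z)=(σJ_2 a_N, σ a_N), which equals (0,σ,σ,0)^T exactly when a_N=(1,0)^T; for other a_N the displayed ξ_0 is wrong (e.g. m_1=m_2=1/2, a_1=(-1,0), a_2=(1,0), a_3=(0,√3) makes H singular there). *)

theory Defs
  imports "HOL-Analysis.Analysis"
begin

text \<open>
  The phase space \<open>\<real>\<^sup>4 = \<real>\<^sup>2 \<times> \<real>\<^sup>2\<close> is indexed by the sum type \<open>2 + 2\<close>: the \<open>Inl\<close> components of
  \<open>\<xi> = (Z, z)\<^sup>T\<close> are the momentum \<open>Z\<close>, the \<open>Inr\<close> components the position \<open>z\<close>.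
\<close>

type_synonym phase = "real ^ (2 + 2)"

definition join :: "real^2 \<Rightarrow> real^2 \<Rightarrow> phase" where
  "join Z z = (\<chi> i. case i of Inl k \<Rightarrow> Z $ k | Inr k \<Rightarrow> z $ k)"

definition mom :: "phase \<Rightarrow> real^2" where
  "mom \<xi> = (\<chi> k. \<xi> $ Inl k)"

definition pos :: "phase \<Rightarrow> real^2" where
  "pos \<xi> = (\<chi> k. \<xi> $ Inr k)"

definition block ::
  "real^2^2 \<Rightarrow> real^2^2 \<Rightarrow> real^2^2 \<Rightarrow> real^2^2 \<Rightarrow> real^(2 + 2)^(2 + 2)" where
  "block A B C D = (\<chi> i j. case i of
      Inl k \<Rightarrow> (case j of Inl l \<Rightarrow> A $ k $ l | Inr l \<Rightarrow> B $ k $ l)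
    | Inr k \<Rightarrow> (case j of Inl l \<Rightarrow> C $ k $ l | Inr l \<Rightarrow> D $ k $ l))"

definition J2 :: "real^2^2" where
  "J2 = vector [vector [0, -1], vector [1, 0]]"

definition J4 :: "real^(2 + 2)^(2 + 2)" where
  "J4 = block 0 (- mat 1) (mat 1) 0"

definition rot :: "real \<Rightarrow> real^2^2" where
  "rot \<theta> = vector [vector [cos \<theta>, - sin \<theta>], vector [sin \<theta>, cos \<theta>]]"

definition outer :: "real^2 \<Rightarrow> real^2 \<Rightarrow> real^2^2" where
  "outer u v = (\<chi> k l. u $ k * v $ l)"


section \<open>Hamiltonian systems, Hessians and linearization\<close>

text \<open>
  A Hamiltonian is a function \<open>H \<theta> Z z\<close> with system \<open>Z' = - \<partial>H/\<partial>z\<close>, \<open>z' = \<partial>H/\<partial>Z\<close>, where the prime is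
  \<open>d/d\<theta>\<close>. The notions are relational, so that each of them includes the existence of the
  derivatives it mentions. Only behaviour near the given phase point matters, hence the value of \<open>H\<close>
  at its collision singularities is irrelevant.
\<close>

definition ham_field ::
  "(real \<Rightarrow> real^2 \<Rightarrow> real^2 \<Rightarrow> real) \<Rightarrow> real \<Rightarrow> phase \<Rightarrow> phase \<Rightarrow> bool" where
  "ham_field H \<theta> \<xi> V \<longleftrightarrow> (\<exists>gZ gz.
      GDERIV (\<lambda>Z. H \<theta> Z (pos \<xi>)) (mom \<xi>) :> gZ \<and>
      GDERIV (\<lambda>z. H \<theta> (mom \<xi>) z) (pos \<xi>) :> gz \<and>
      V = join (- gz) gZ)"

definition solves_ham_at ::
  "(real \<Rightarrow> real^2 \<Rightarrow> real^2 \<Rightarrow> real) \<Rightarrow> (real \<Rightarrow> phase) \<Rightarrow> real \<Rightarrow> bool" where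
  "solves_ham_at H \<xi> \<theta> \<longleftrightarrow>
     (\<exists>V. ham_field H \<theta> (\<xi> \<theta>) V \<and> (\<xi> has_vector_derivative V) (at \<theta>))"

text \<open>\<open>A\<close> is the matrix of the linearization of the Hamiltonian vector field at \<open>\<xi>\<close>.\<close>

definition ham_linearization ::
  "(real \<Rightarrow> real^2 \<Rightarrow> real^2 \<Rightarrow> real) \<Rightarrow> real \<Rightarrow> phase \<Rightarrow> real^(2 + 2)^(2 + 2) \<Rightarrow> bool" where
  "ham_linearization H \<theta> \<xi> A \<longleftrightarrow> (\<exists>X.
      (\<forall>\<^sub>F \<eta> in nhds \<xi>. ham_field H \<theta> \<eta> (X \<eta>)) \<and>
      (X has_derivative (\<lambda>h. A *v h)) (at \<xi>))"

text \<open>\<open>\<xi>\<close> satisfies, at \<open>\<theta>\<close>, the Hamiltonian system linearized along \<open>\<xi>0\<close>.\<close>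

definition solves_linearized_at ::
  "(real \<Rightarrow> real^2 \<Rightarrow> real^2 \<Rightarrow> real) \<Rightarrow> (real \<Rightarrow> phase) \<Rightarrow> (real \<Rightarrow> phase) \<Rightarrow> real \<Rightarrow> bool" where
  "solves_linearized_at H \<xi>0 \<xi> \<theta> \<longleftrightarrow>
     (\<exists>A. ham_linearization H \<theta> (\<xi>0 \<theta>) A \<and> (\<xi> has_vector_derivative (A *v \<xi> \<theta>)) (at \<theta>))"

definition has_hessian ::
  "(phase \<Rightarrow> real) \<Rightarrow> phase \<Rightarrow> real^(2 + 2)^(2 + 2) \<Rightarrow> bool" where
  "has_hessian f \<xi> M \<longleftrightarrow> (\<exists>g.
      (\<forall>\<^sub>F \<eta> in nhds \<xi>. GDERIV f \<eta> :> g \<eta>) \<and>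
      (g has_derivative (\<lambda>h. M *v h)) (at \<xi>))"


section \<open>The restricted N-body problem\<close>

definition normalized_restricted_cc :: "nat \<Rightarrow> (nat \<Rightarrow> real) \<Rightarrow> (nat \<Rightarrow> real^2) \<Rightarrow> real \<Rightarrow> bool" where
  "normalized_restricted_cc N m a \<mu> \<longleftrightarrow>
     inj_on a {1..N} \<and>
     (\<Sum>i\<in>{1..N-1}. m i * (norm (a i))\<^sup>2) = 1 \<and>
     \<mu> = (\<Sum>(i, j)\<in>{(i, j). 1 \<le> i \<and> i < j \<and> j \<le> N - 1}. m i * m j / norm (a i - a j)) \<and>
     (\<forall>i\<in>{1..N}.
        (\<Sum>j\<in>{1..N-1} - {i}. (m j / (norm (a j - a i)) ^ 3) *\<^sub>R (a j - a i)) = - \<mu> *\<^sub>R a i)"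

definition kepler_r :: "real \<Rightarrow> real \<Rightarrow> real \<Rightarrow> real" where
  "kepler_r p e \<theta> = p / (1 + e * cos \<theta>)"

definition H_red ::
  "nat \<Rightarrow> (nat \<Rightarrow> real) \<Rightarrow> (nat \<Rightarrow> real^2) \<Rightarrow> real \<Rightarrow> real \<Rightarrow> real
    \<Rightarrow> real \<Rightarrow> real^2 \<Rightarrow> real^2 \<Rightarrow> real" where
  "H_red N m a \<sigma> p e \<theta> Z z =
     (norm Z)\<^sup>2 / 2 + z \<bullet> (J2 *v Z) + (p - kepler_r p e \<theta>) / (2 * p) * (norm z)\<^sup>2
     - kepler_r p e \<theta> / \<sigma> * (\<Sum>i\<in>{1..N-1}. m i / norm (\<sigma> *\<^sub>R a i - z))"

text \<open>
  The canonical change of variables behind \<open>H_red\<close>: with \<open>r = r(\<theta>(t))\<close> and \<open>r' = dr/dt\<close>, position and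
  momentum of the massless body are
  \<open>q = (r/\<sigma>) R(\<theta>) z\<close> and \<open>P = R(\<theta>) ((\<sigma>/r) Z + (r'/\<sigma>) z)\<close>.
  This is the relation forced by \<open>P = dq/dt\<close>, \<open>r\<^sup>2 d\<theta>/dt = \<sigma>\<^sup>2\<close> and
  \<open>dz/d\<theta> = \<partial>H/\<partial>Z = Z - J2 z\<close>. Below it is solved for \<open>(Z, z)\<close>.
\<close>

definition reduced_coords ::
  "real \<Rightarrow> real \<Rightarrow> real \<Rightarrow> real \<Rightarrow> real^2 \<Rightarrow> real^2 \<Rightarrow> phase" where
  "reduced_coords \<sigma> r r' \<theta> P q =
     join ((r / \<sigma>) *\<^sub>R (rot (- \<theta>) *v P) - (r' / \<sigma>) *\<^sub>R (rot (- \<theta>) *v q))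
          ((\<sigma> / r) *\<^sub>R (rot (- \<theta>) *v q))"

text \<open>
  The elliptic relative equilibrium \<open>q = r R(\<theta>) c\<close>, \<open>P = dq/dt\<close> in these coordinates. It is
  \<open>(0, \<sigma>, \<sigma>, 0)\<^sup>T\<close> exactly when the plane is coordinatized so that \<open>c = (1, 0)\<^sup>T\<close>.
\<close>

definition ere :: "real \<Rightarrow> real^2 \<Rightarrow> phase" where
  "ere \<sigma> c = join (\<sigma> *\<^sub>R (J2 *v c)) (\<sigma> *\<^sub>R c)"

definition D_mat :: "nat \<Rightarrow> (nat \<Rightarrow> real) \<Rightarrow> (nat \<Rightarrow> real^2) \<Rightarrow> real \<Rightarrow> real^2^2" where
  "D_mat N m a \<mu> =
     mat 1 - (1 / \<mu> * (\<Sum>i\<in>{1..N-1}. m i / (norm (a i - a N)) ^ 3)) *\<^sub>R mat 1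
     + (3 / \<mu>) *\<^sub>R (\<Sum>i\<in>{1..N-1}.
         (m i / (norm (a i - a N)) ^ 5) *\<^sub>R outer (a i - a N) (a i - a N))"

definition B_mat ::
  "nat \<Rightarrow> (nat \<Rightarrow> real) \<Rightarrow> (nat \<Rightarrow> real^2) \<Rightarrow> real \<Rightarrow> real \<Rightarrow> real \<Rightarrow> real^(2 + 2)^(2 + 2)" where
  "B_mat N m a \<mu> e \<theta> =
     block (mat 1) (- J2) J2 (mat 1 - (1 / (1 + e * cos \<theta>)) *\<^sub>R D_mat N m a \<mu>)"

definition H2 ::
  "nat \<Rightarrow> (nat \<Rightarrow> real) \<Rightarrow> (nat \<Rightarrow> real^2) \<Rightarrow> real \<Rightarrow> real
    \<Rightarrow> real \<Rightarrow> real^2 \<Rightarrow> real^2 \<Rightarrow> real" where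
  "H2 N m a \<mu> e \<theta> Z z =
     (norm Z)\<^sup>2 / 2 + z \<bullet> (J2 *v Z)
     + (z \<bullet> ((mat 1 - (1 / (1 + e * cos \<theta>)) *\<^sub>R D_mat N m a \<mu>) *v z)) / 2"

end

theory Submission
  imports Defs
begin

text \<open>
  \<open>H_red\<close> is a quadratic form with matrix \<open>block 1 (- J2) J2 ((1 - r/p) 1)\<close> minus a Newton potential in
  the position. Away from collisions its gradient is therefore explicit, and vanishes at \<open>ere \<sigma> (a N)\<close>
  by the central configuration equation for the massless body together with \<open>\<sigma>\<^sup>4 = \<mu> p\<close>.
  Differentiating once more, the homogeneity of the potential produces the factor
  \<open>(r/\<sigma>) \<sigma>\<^sup>-\<^sup>3 = 1 / (\<mu> (1 + e cos \<theta>))\<close>, which turns the tidal matrices into \<open>D_mat\<close>. The Hamiltonian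
  vector field is \<open>J4\<close> times the gradient, so the linearization is \<open>J4\<close> times the Hessian.
\<close>

section \<open>Splitting phase space into momentum and position blocks\<close>

lemma mom_join [simp]: "mom (join Z z) = Z" and pos_join [simp]: "pos (join Z z) = z"
  by (simp_all add: mom_def pos_def join_def vec_eq_iff)

lemma join_mom_pos [simp]: "join (mom \<xi>) (pos \<xi>) = \<xi>"
  by (simp add: mom_def pos_def join_def vec_eq_iff split: sum.split)

lemma join_eq_iff: "join Z z = join Y y \<longleftrightarrow> Z = Y \<and> z = y"
  by (metis mom_join pos_join)

lemma join_add: "join Z z + join Y y = join (Z + Y) (z + y)"
  by (simp add: join_def vec_eq_iff split: sum.split)

text \<open>Splits sums over the index type \<open>2 + 2\<close>; inner products and block matrices
  on phase space then reduce to computations in the plane.\<close>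

lemma sum_UNIV_Plus:
  fixes f :: "'a::finite + 'b::finite \<Rightarrow> 'c::comm_monoid_add"
  shows "sum f UNIV = (\<Sum>k\<in>UNIV. f (Inl k)) + (\<Sum>k\<in>UNIV. f (Inr k))"
  by (simp add: UNIV_Plus_UNIV [symmetric] sum.Plus del: UNIV_Plus_UNIV)

lemma inner_phase: "x \<bullet> y = mom x \<bullet> mom y + pos x \<bullet> pos y"
  by (simp add: inner_vec_def sum_UNIV_Plus mom_def pos_def)

lemma block_mult_join:
  "block A B C D *v join Z z = join (A *v Z + B *v z) (C *v Z + D *v z)"
  by (simp add: block_def join_def matrix_vector_mult_def sum_UNIV_Plus vec_eq_iff split: sum.split)

lemma bounded_linear_pos: "bounded_linear pos"
  by (auto intro!: linear_conv_bounded_linear [THEN iffD1] linearI simp: pos_def vec_eq_iff)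

lemma matrix_vector_mult_minus_left: "(- A) *v x = - (A *v x)" for A :: "real^'n^'m"
  using matrix_vector_mult_diff_rdistrib [of 0 A x] by simp

lemma bounded_linear_join: "bounded_linear (\<lambda>Z. join Z 0)" "bounded_linear (\<lambda>z. join 0 z)"
  by (auto intro!: linear_conv_bounded_linear [THEN iffD1] linearI
      simp: join_def vec_eq_iff split: sum.split)

section \<open>Hamiltonian vector fields, gradients and linearizations\<close>

lemma J4_mult: "J4 *v g = join (- pos g) (mom g)"
  using block_mult_join [of 0 "- mat 1" "mat 1" 0 "mom g" "pos g"]
  by (simp add: J4_def matrix_vector_mult_minus_left)

lemma J2_mult: "J2 *v x = vector [- x $ 2, x $ 1]"
  by (simp add: J2_def matrix_vector_mult_def vec_eq_iff forall_2 sum_2)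

text \<open>The partial gradients come from the chain rule along the affine slices through
  \<open>\<xi>\<close> with one block fixed: they are the two blocks of \<open>g\<close>, and
  \<open>J4\<close> exchanges them with the sign of Hamilton's equations.\<close>

lemma ham_field_of_GDERIV:
  assumes "GDERIV (\<lambda>\<eta>. H \<theta> (mom \<eta>) (pos \<eta>)) \<xi> :> g"
  shows "ham_field H \<theta> \<xi> (J4 *v g)"
proof -
  have H: "((\<lambda>\<eta>. H \<theta> (mom \<eta>) (pos \<eta>)) has_derivative (\<lambda>h. h \<bullet> g)) (at \<xi>)"
    using assms by (simp add: gderiv_def)
  have join_deriv: "((\<lambda>Z. join Z z) has_derivative (\<lambda>h. join h 0)) F"
     "((\<lambda>z. join Z z) has_derivative (\<lambda>h. join 0 h)) F" for Z z F
  proof -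
    \<comment> \<open>With one argument fixed, \<open>join\<close> is a linear map plus a
      constant.\<close>
    have "((\<lambda>Z. join Z 0 + join 0 z) has_derivative (\<lambda>h. join h 0 + 0)) F"
      "((\<lambda>z. join Z 0 + join 0 z) has_derivative (\<lambda>h. 0 + join 0 h)) F"
      by (intro derivative_intros bounded_linear_join [THEN bounded_linear_imp_has_derivative])+
    then show "((\<lambda>Z. join Z z) has_derivative (\<lambda>h. join h 0)) F"
     "((\<lambda>z. join Z z) has_derivative (\<lambda>h. join 0 h)) F" by (simp_all add: join_add)
  qed
  have "((\<lambda>Z. H \<theta> Z (pos \<xi>)) has_derivative (\<lambda>h. h \<bullet> mom g)) (at (mom \<xi>))"
    using has_derivative_compose [OF join_deriv(1) [where z = "pos \<xi>"],
        where x = "mom \<xi>" and s = UNIV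
        and g = "\<lambda>\<eta>. H \<theta> (mom \<eta>) (pos \<eta>)" and g' = "\<lambda>h. h \<bullet> g"] H
    by (simp add: inner_phase [where y = g])
  moreover have "((\<lambda>z. H \<theta> (mom \<xi>) z) has_derivative (\<lambda>h. h \<bullet> pos g)) (at (pos \<xi>))"
    using has_derivative_compose [OF join_deriv(2) [where Z = "mom \<xi>"],
        where x = "pos \<xi>" and s = UNIV
        and g = "\<lambda>\<eta>. H \<theta> (mom \<eta>) (pos \<eta>)" and g' = "\<lambda>h. h \<bullet> g"] H
    by (simp add: inner_phase [where y = g])
  ultimately show ?thesis
    unfolding ham_field_def J4_mult gderiv_def by blast
qed

lemma GDERIV_unique: "GDERIV f x :> g \<Longrightarrow> GDERIV f x :> g' \<Longrightarrow> g = g'"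
  unfolding gderiv_def
  by (metis has_derivative_unique vector_eq_ldot)

text \<open>Uniqueness of both partial gradients makes the relational field single-valued. The
  equivalences for solutions rest on this.\<close>

lemma ham_field_unique: "ham_field H \<theta> \<xi> V \<Longrightarrow> ham_field H \<theta> \<xi> W \<Longrightarrow> V = W"
  unfolding ham_field_def by (metis GDERIV_unique)

text \<open>The field is \<open>J4\<close> applied to the gradient near \<open>\<xi>\<close>, and
  the constant matrix \<open>J4\<close> commutes with differentiation.\<close>

lemma ham_linearization_of_hessian:
  assumes "has_hessian (\<lambda>\<eta>. H \<theta> (mom \<eta>) (pos \<eta>)) \<xi> M"
  shows "ham_linearization H \<theta> \<xi> (J4 ** M)"
proof -
  obtain g where g: "\<forall>\<^sub>F \<eta> in nhds \<xi>. GDERIV (\<lambda>\<eta>. H \<theta> (mom \<eta>) (pos \<eta>)) \<eta> :> g \<eta>"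
    "(g has_derivative (*v) M) (at \<xi>)"
    using assms unfolding has_hessian_def by auto
  have "\<forall>\<^sub>F \<eta> in nhds \<xi>. ham_field H \<theta> \<eta> (J4 *v g \<eta>)"
    using g(1) by (rule eventually_mono) (rule ham_field_of_GDERIV)
  moreover have "((\<lambda>\<eta>. J4 *v g \<eta>) has_derivative (\<lambda>h. (J4 ** M) *v h)) (at \<xi>)"
    using bounded_linear.has_derivative [OF matrix_vector_mul_bounded_linear g(2)]
    by (simp add: matrix_vector_mul_assoc)
  ultimately show ?thesis
    unfolding ham_linearization_def by (intro exI [of _ "\<lambda>\<eta>. J4 *v g \<eta>"]) simp
qed

text \<open>Two admissible fields agree on a neighbourhood of \<open>\<xi>\<close>, hence have the
  same derivative there, and a matrix is determined by its linear map.\<close>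

lemma ham_linearization_unique:
  assumes "ham_linearization H \<theta> \<xi> A" "ham_linearization H \<theta> \<xi> B"
  shows "A = B"
proof -
  obtain X Y where X: "\<forall>\<^sub>F \<eta> in nhds \<xi>. ham_field H \<theta> \<eta> (X \<eta>)" "(X has_derivative (*v) A) (at \<xi>)"
    and Y: "\<forall>\<^sub>F \<eta> in nhds \<xi>. ham_field H \<theta> \<eta> (Y \<eta>)" "(Y has_derivative (*v) B) (at \<xi>)"
    using assms unfolding ham_linearization_def by auto
  have ev: "\<forall>\<^sub>F \<eta> in nhds \<xi>. Y \<eta> = X \<eta>"
    using X(1) Y(1) by eventually_elim (rule ham_field_unique)
  then have "(X has_derivative (*v) B) (at \<xi>)"
    using Y(2) has_derivative_transform_eventually [of Y "(*v) B" \<xi> UNIV X]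
    by (auto simp: eventually_nhds_conv_at)
  then have "(*v) A = (*v) B"
    using X(2) has_derivative_unique by blast
  then show ?thesis
    by (simp add: matrix_eq fun_eq_iff)
qed

lemma solves_linearized_at_iff:
  assumes "ham_linearization H \<theta> (\<xi>0 \<theta>) A"
  shows "solves_linearized_at H \<xi>0 \<xi> \<theta> \<longleftrightarrow> (\<xi> has_vector_derivative A *v \<xi> \<theta>) (at \<theta>)"
  using assms ham_linearization_unique unfolding solves_linearized_at_def by blast

lemma solves_ham_at_iff:
  assumes "ham_field H \<theta> (\<xi> \<theta>) V"
  shows "solves_ham_at H \<xi> \<theta> \<longleftrightarrow> (\<xi> has_vector_derivative V) (at \<theta>)"
  using assms ham_field_unique unfolding solves_ham_at_def by blast

section \<open>Derivatives of quadratic forms and of the Newton potential\<close>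

lemma GDERIV_quadratic_form:
  fixes M :: "real^'n^'n"
  assumes "transpose M = M"
  shows "GDERIV (\<lambda>x. (x \<bullet> (M *v x)) / 2) x :> M *v x"
proof -
  have "((\<lambda>x. (x \<bullet> (M *v x)) / 2) has_derivative (\<lambda>h. (x \<bullet> (M *v h) + h \<bullet> (M *v x)) / 2)) (at x)"
    by (auto intro!: derivative_eq_intros bounded_linear.has_derivative [OF matrix_vector_mul_bounded_linear])
  \<comment> \<open>Symmetry of \<open>M\<close> makes the two product rule terms equal, which
    absorbs the factor 1/2.\<close>
  moreover have "x \<bullet> (M *v h) = h \<bullet> (M *v x)" for h
    using dot_lmul_matrix [of x M h] assms
    by (metis inner_commute transpose_matrix_vector)
  ultimately show ?thesis
    by (simp add: gderiv_def)
qed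


lemma GDERIV_sum:
  assumes "\<And>i. i \<in> I \<Longrightarrow> GDERIV (f i) x :> g i"
  shows "GDERIV (\<lambda>x. \<Sum>i\<in>I. f i x) x :> (\<Sum>i\<in>I. g i)"
  using has_derivative_sum [of I f "\<lambda>i h. h \<bullet> g i" "at x"] assms
  by (simp add: gderiv_def inner_sum_right)

text \<open>Away from the origin the norm has gradient \<open>sgn\<close>, so the reciprocal of the
  distance contributes the unit vector over the squared distance. The orientation
  \<open>z - b\<close> suits the second differentiation.\<close>

lemma GDERIV_Newton_potential:
  fixes b z :: "'a::real_inner"
  assumes "z \<noteq> b"
  shows "GDERIV (\<lambda>z. m / norm (b - z)) z :> - ((m / norm (z - b) ^ 3) *\<^sub>R (z - b))"
proof -
  have "((\<lambda>z. z - b) has_derivative (\<lambda>h. h)) (at z)"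
    by (auto intro!: derivative_eq_intros)
  from has_derivative_compose [OF this has_derivative_norm] assms
  have n: "((\<lambda>z. norm (z - b)) has_derivative (\<lambda>h. h \<bullet> sgn (z - b))) (at z)"
    by simp
  have "((\<lambda>z. m / norm (z - b)) has_derivative (\<lambda>h. h \<bullet> - ((m / norm (z - b) ^ 3) *\<^sub>R (z - b)))) (at z)"
    using assms n
    by (auto intro!: derivative_eq_intros simp: sgn_div_norm power3_eq_cube divide_simps)
  then show ?thesis
    by (simp add: gderiv_def norm_minus_commute)
qed

text \<open>\<open>tidal d\<close> is the derivative of the force field \<open>d / |d|\<^sup>3\<close>, i.e. the Hessian of \<open>- 1 / |d|\<close>.\<close>

definition tidal :: "real^2 \<Rightarrow> real^2^2" where
  "tidal d = (1 / norm d ^ 3) *\<^sub>R mat 1 - (3 / norm d ^ 5) *\<^sub>R outer d d"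

lemma outer_mult: "outer u v *v h = (v \<bullet> h) *\<^sub>R u"
  by (simp add: outer_def matrix_vector_mult_def inner_vec_def vec_eq_iff sum_distrib_right
      sum_distrib_left mult_ac)

text \<open>Product rule: differentiating the vector gives the identity part of
  \<open>tidal\<close>, differentiating the inverse cube of the distance gives the rank-one
  part.\<close>

lemma has_derivative_Newton_force:
  fixes b z :: "real^2"
  assumes "z \<noteq> b"
  shows "((\<lambda>z. (m / norm (z - b) ^ 3) *\<^sub>R (z - b)) has_derivative (\<lambda>h. (m *\<^sub>R tidal (z - b)) *v h)) (at z)"
proof -
  have "((\<lambda>z. z - b) has_derivative (\<lambda>h. h)) (at z)"
    by (auto intro!: derivative_eq_intros)
  from has_derivative_compose [OF this has_derivative_norm] assms
  have n: "((\<lambda>z. norm (z - b)) has_derivative (\<lambda>h. h \<bullet> sgn (z - b))) (at z)"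
    by simp
  have eq: "(m *\<^sub>R tidal (z - b)) *v h = (m / norm (z - b) ^ 3) *\<^sub>R h
      - (3 * m * (h \<bullet> (z - b)) / norm (z - b) ^ 5) *\<^sub>R (z - b)" for h
    by (simp add: tidal_def outer_mult matrix_vector_mult_diff_rdistrib inner_commute
        scaleR_diff_right mult.commute [of m 3] flip: scaleR_matrix_vector_assoc)
  have "((\<lambda>z. (m / norm (z - b) ^ 3) *\<^sub>R (z - b)) has_derivative
     (\<lambda>h. (m / norm (z - b) ^ 3) *\<^sub>R h
      + (- m * (3 * (h \<bullet> sgn (z - b)) * norm (z - b) ^ 2) / (norm (z - b) ^ 3 * norm (z - b) ^ 3)) *\<^sub>R (z - b))) (at z)"
    using assms
    by (auto intro!: derivative_eq_intros n)
  moreover have "- m * (3 * (h \<bullet> sgn (z - b)) * norm (z - b) ^ 2) / (norm (z - b) ^ 3 * norm (z - b) ^ 3)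
      = - (3 * m * (h \<bullet> (z - b)) / norm (z - b) ^ 5)" for h
    using assms by (simp add: sgn_div_norm divide_simps) (simp add: eval_nat_numeral)
  ultimately show ?thesis
    by (simp add: eq)
qed

section \<open>Gradient and Hessian of the reduced Hamiltonian\<close>

definition grad_H_red ::
  "nat \<Rightarrow> (nat \<Rightarrow> real) \<Rightarrow> (nat \<Rightarrow> real^2) \<Rightarrow> real \<Rightarrow> real \<Rightarrow> real \<Rightarrow> real \<Rightarrow> phase \<Rightarrow> phase" where
  "grad_H_red N m a \<sigma> p e \<theta> \<eta> =
     block (mat 1) (- J2) J2 ((1 - kepler_r p e \<theta> / p) *\<^sub>R mat 1) *v \<eta>
     + join 0 ((kepler_r p e \<theta> / \<sigma>) *\<^sub>R (\<Sum>i\<in>{1..N-1}.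
         (m i / norm (pos \<eta> - \<sigma> *\<^sub>R a i) ^ 3) *\<^sub>R (pos \<eta> - \<sigma> *\<^sub>R a i)))"

lemma transpose_block:
  "transpose (block A B C D) = block (transpose A) (transpose C) (transpose B) (transpose D)"
  by (simp add: block_def transpose_def vec_eq_iff split: sum.split)

lemma transpose_J2: "transpose J2 = - J2"
  by (simp add: J2_def transpose_def vec_eq_iff forall_2)

text \<open>Since \<open>J2\<close> is skew, the off-diagonal blocks \<open>- J2\<close> and
  \<open>J2\<close> are transposes of each other.\<close>

lemma transpose_block_J2:
  "transpose S = S \<Longrightarrow> transpose (block (mat 1) (- J2) J2 S) = block (mat 1) (- J2) J2 S"
  using transpose_J2
  by (simp add: transpose_block transpose_mat) (metis add.inverse_inverse transpose_transpose)

lemma J2_skew: "Z \<bullet> (J2 *v z) = - (z \<bullet> (J2 *v Z))"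
  by (simp add: J2_mult inner_vec_def sum_2)

text \<open>By skewness both off-diagonal blocks contribute the same term, so halving leaves one
  copy of the coupling. With a suitable \<open>S\<close> this covers \<open>H2\<close> and the
  quadratic part of \<open>H_red\<close>.\<close>

lemma block_J2_form:
  "(join Z z \<bullet> (block (mat 1) (- J2) J2 S *v join Z z)) / 2
    = (norm Z)\<^sup>2 / 2 + z \<bullet> (J2 *v Z) + (z \<bullet> (S *v z)) / 2"
  by (simp add: block_mult_join inner_phase inner_add_right inner_diff_right matrix_vector_mult_minus_left
      J2_skew [of Z z] power2_norm_eq_inner field_simps)

text \<open>Chain rule through the projection \<open>pos\<close>, whose adjoint is
  \<open>join 0\<close>.\<close>

lemma GDERIV_pos:
  assumes "GDERIV U (pos \<eta>) :> g"
  shows "GDERIV (\<lambda>\<eta>. U (pos \<eta>)) \<eta> :> join 0 g"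
  using has_derivative_compose [OF bounded_linear_imp_has_derivative [OF bounded_linear_pos],
      of U _ \<eta>] assms
  by (simp add: gderiv_def inner_phase)

lemma GDERIV_H_red:
  assumes p: "p \<noteq> 0" and free: "\<And>i. i \<in> {1..N-1} \<Longrightarrow> pos \<eta> \<noteq> \<sigma> *\<^sub>R a i"
  shows "GDERIV (\<lambda>\<eta>. H_red N m a \<sigma> p e \<theta> (mom \<eta>) (pos \<eta>)) \<eta> :> grad_H_red N m a \<sigma> p e \<theta> \<eta>"
proof -
  let ?r = "kepler_r p e \<theta>"
  let ?S = "(1 - ?r / p) *\<^sub>R mat 1 :: real^2^2"
  let ?M = "block (mat 1) (- J2) J2 ?S"
  let ?W = "\<lambda>z. \<Sum>i\<in>{1..N-1}. m i / norm (\<sigma> *\<^sub>R a i - z)"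
  have "GDERIV ?W (pos \<eta>) :> - (\<Sum>i\<in>{1..N-1}. 
         (m i / norm (pos \<eta> - \<sigma> *\<^sub>R a i) ^ 3) *\<^sub>R (pos \<eta> - \<sigma> *\<^sub>R a i))" (is "GDERIV _ _ :> - ?F")
    unfolding sum_negf [symmetric] by (intro GDERIV_sum GDERIV_Newton_potential free)
  then have "GDERIV (\<lambda>z. ?r / \<sigma> * ?W z) (pos \<eta>) :> (?r / \<sigma>) *\<^sub>R (- ?F) + ?W (pos \<eta>) *\<^sub>R 0"
    by (intro GDERIV_mult GDERIV_const)
  then have W: "GDERIV (\<lambda>\<eta>. ?r / \<sigma> * ?W (pos \<eta>)) \<eta> :> join 0 ((?r / \<sigma>) *\<^sub>R (- ?F))"
    by (intro GDERIV_pos) simp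
  have "transpose ?M = ?M"
    by (intro transpose_block_J2) (simp add: transpose_def mat_def vec_eq_iff)
  from GDERIV_diff [OF GDERIV_quadratic_form [OF this] W]
  have "GDERIV (\<lambda>\<eta>. (\<eta> \<bullet> (?M *v \<eta>)) / 2 - ?r / \<sigma> * ?W (pos \<eta>)) \<eta>
      :> ?M *v \<eta> - join 0 ((?r / \<sigma>) *\<^sub>R (- ?F))" .
  moreover have "?M *v \<eta> - join 0 ((?r / \<sigma>) *\<^sub>R (- ?F)) = grad_H_red N m a \<sigma> p e \<theta> \<eta>"
    unfolding grad_H_red_def diff_conv_add_uminus
    by (simp add: join_def vec_eq_iff split: sum.split)
  \<comment> \<open>The coefficient \<open>(p - r) / (2 * p)\<close> is half of
    \<open>1 - r / p\<close>; this is where \<open>p \<noteq> 0\<close> enters.\<close>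
  moreover have "(\<eta> \<bullet> (?M *v \<eta>)) / 2 - ?r / \<sigma> * ?W (pos \<eta>) = H_red N m a \<sigma> p e \<theta> (mom \<eta>) (pos \<eta>)" for \<eta>
    using block_J2_form [of "mom \<eta>" "pos \<eta>" ?S] p
    by (simp add: H_red_def power2_norm_eq_inner diff_divide_distrib flip: scaleR_matrix_vector_assoc)
  ultimately show ?thesis
    by simp
qed

lemma has_hessian_H_red:
  assumes p: "p \<noteq> 0" and free: "\<And>i. i \<in> {1..N-1} \<Longrightarrow> pos \<eta> \<noteq> \<sigma> *\<^sub>R a i"
  shows "has_hessian (\<lambda>\<eta>. H_red N m a \<sigma> p e \<theta> (mom \<eta>) (pos \<eta>)) \<eta>
    (block (mat 1) (- J2) J2 ((1 - kepler_r p e \<theta> / p) *\<^sub>R mat 1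
       + (kepler_r p e \<theta> / \<sigma>) *\<^sub>R (\<Sum>i\<in>{1..N-1}. m i *\<^sub>R tidal (pos \<eta> - \<sigma> *\<^sub>R a i))))"
    (is "has_hessian _ _ (block _ _ _ (?S + ?k *\<^sub>R ?T))")
proof -
  let ?G = "grad_H_red N m a \<sigma> p e \<theta>"
  have cont: "isCont pos \<eta>"
    by (rule bounded_linear.isCont [OF bounded_linear_pos continuous_ident])
  \<comment> \<open>A Hessian requires the gradient on a whole neighbourhood. Avoiding finitely many
    collision points persists near \<open>\<eta>\<close> by continuity of
    \<open>pos\<close>.\<close>
  have "\<forall>\<^sub>F \<zeta> in nhds \<eta>. \<forall>i\<in>{1..N-1}. pos \<zeta> \<noteq> \<sigma> *\<^sub>R a i"
  proof (intro eventually_ball_finite ballI finite_atLeastAtMost)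
    fix i assume "i \<in> {1..N-1}"
    then show "\<forall>\<^sub>F \<zeta> in nhds \<eta>. pos \<zeta> \<noteq> \<sigma> *\<^sub>R a i"
      using free tendsto_imp_eventually_ne [OF cont [unfolded isCont_def]]
      by (auto simp: eventually_nhds_conv_at)
  qed
  then have "\<forall>\<^sub>F \<zeta> in nhds \<eta>. GDERIV (\<lambda>\<eta>. H_red N m a \<sigma> p e \<theta> (mom \<eta>) (pos \<eta>)) \<zeta> :> ?G \<zeta>"
    by (rule eventually_mono) (intro GDERIV_H_red p, blast)
  moreover have "(?G has_derivative (\<lambda>h. block (mat 1) (- J2) J2 (?S + ?k *\<^sub>R ?T) *v h)) (at \<eta>)"
  proof -
    let ?F = "\<lambda>z. \<Sum>i\<in>{1..N-1}. (m i / norm (z - \<sigma> *\<^sub>R a i) ^ 3) *\<^sub>R (z - \<sigma> *\<^sub>R a i)"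
    have "(?F has_derivative (\<lambda>h. \<Sum>i\<in>{1..N-1}. (m i *\<^sub>R tidal (pos \<eta> - \<sigma> *\<^sub>R a i)) *v h)) (at (pos \<eta>))"
      by (intro has_derivative_sum has_derivative_Newton_force free)
    then have "((\<lambda>\<zeta>. ?F (pos \<zeta>)) has_derivative 
        (\<lambda>h. \<Sum>i\<in>{1..N-1}. (m i *\<^sub>R tidal (pos \<eta> - \<sigma> *\<^sub>R a i)) *v pos h)) (at \<eta>)"
      by (rule has_derivative_compose [OF bounded_linear_imp_has_derivative [OF bounded_linear_pos]])
    moreover have "(\<Sum>i\<in>I. A i *v x) = (\<Sum>i\<in>I. A i) *v x" 
      for I :: "nat set" and A :: "nat \<Rightarrow> real^2^2" and x
      by (induction I rule: infinite_finite_induct) (simp_all add: matrix_vector_mult_add_rdistrib)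
    ultimately have F: "((\<lambda>\<zeta>. ?F (pos \<zeta>)) has_derivative (\<lambda>h. ?T *v pos h)) (at \<eta>)"
      by simp
    have "(?G has_derivative (\<lambda>h. block (mat 1) (- J2) J2 ?S *v h + join 0 (?k *\<^sub>R (?T *v pos h)))) (at \<eta>)"
      unfolding grad_H_red_def
      by (intro has_derivative_add bounded_linear.has_derivative [OF bounded_linear_join(2)]
          has_derivative_scaleR_right F bounded_linear_imp_has_derivative
          matrix_vector_mul_bounded_linear)
    \<comment> \<open>The force depends on the position only and acts on the momentum equation only,
      so its derivative enters just the lower right block.\<close>
    moreover have "block (mat 1) (- J2) J2 ?S *v h + join 0 (?k *\<^sub>R (?T *v pos h))
        = block (mat 1) (- J2) J2 (?S + ?k *\<^sub>R ?T) *v h" for h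
      using block_mult_join [of "mat 1" "- J2" J2 _ "mom h" "pos h"]
      by (simp add: join_add matrix_vector_mult_add_rdistrib add_ac flip: scaleR_matrix_vector_assoc)
    ultimately show ?thesis
      by simp
  qed
  ultimately show ?thesis
    unfolding has_hessian_def by blast
qed

section \<open>Hessian block and gradient at the relative equilibrium\<close>

lemma tidal_scaleR: "\<sigma> > 0 \<Longrightarrow> tidal (\<sigma> *\<^sub>R d) = (1 / \<sigma> ^ 3) *\<^sub>R tidal d"
  by (simp add: tidal_def outer_def vec_eq_iff power_mult_distrib eval_nat_numeral algebra_simps)

text \<open>The weighted tidal matrices at \<open>a N\<close> sum to
  \<open>\<mu> *\<^sub>R (mat 1 - D_mat N m a \<mu>)\<close>. After rescaling, their coefficient is
  \<open>r / p\<close>, so the multiples of the identity cancel and only \<open>D_mat\<close> keeps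
  this factor.\<close>

lemma hessian_block_eq:
  assumes p: "p > 0" and \<mu>: "\<mu> > 0" and \<sigma>: "\<sigma> > 0" "\<sigma> ^ 4 = \<mu> * p"
  shows "(1 - kepler_r p e \<theta> / p) *\<^sub>R mat 1
       + (kepler_r p e \<theta> / \<sigma>) *\<^sub>R (\<Sum>i\<in>{1..N-1}. m i *\<^sub>R tidal (\<sigma> *\<^sub>R a N - \<sigma> *\<^sub>R a i))
     = mat 1 - (1 / (1 + e * cos \<theta>)) *\<^sub>R D_mat N m a \<mu>"
proof -
  \<comment> \<open>\<open>tidal\<close> is even and homogeneous of degree -3.\<close>
  have tid: "tidal (\<sigma> *\<^sub>R a N - \<sigma> *\<^sub>R a i) = (1 / \<sigma> ^ 3) *\<^sub>R tidal (a i - a N)" for i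
  proof -
    have "tidal (a N - a i) = tidal (a i - a N)"
      by (simp add: tidal_def outer_def norm_minus_commute vec_eq_iff algebra_simps)
    then show ?thesis
      using tidal_scaleR [OF \<sigma>(1), of "a N - a i"] by (simp add: scaleR_diff_right)
  qed
  have "(\<Sum>i\<in>{1..N-1}. m i *\<^sub>R tidal (\<sigma> *\<^sub>R a N - \<sigma> *\<^sub>R a i))
     = (1 / \<sigma> ^ 3) *\<^sub>R (\<Sum>i\<in>{1..N-1}. m i *\<^sub>R tidal (a i - a N))"
    unfolding tid scaleR_sum_right by (simp add: mult.commute)
  also have "(\<Sum>i\<in>{1..N-1}. m i *\<^sub>R tidal (a i - a N))
     = (\<Sum>i\<in>{1..N-1}. m i / (norm (a i - a N)) ^ 3) *\<^sub>R mat 1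
       - 3 *\<^sub>R (\<Sum>i\<in>{1..N-1}. (m i / (norm (a i - a N)) ^ 5) *\<^sub>R outer (a i - a N) (a i - a N))"
    by (simp add: tidal_def scaleR_sum_left scaleR_sum_right scaleR_diff_right sum_subtractf mult.commute)
  also have "\<dots> = \<mu> *\<^sub>R (mat 1 - D_mat N m a \<mu>)"
    using \<mu> by (simp add: D_mat_def scaleR_diff_right scaleR_add_right algebra_simps)
  finally have T: "(\<Sum>i\<in>{1..N-1}. m i *\<^sub>R tidal (\<sigma> *\<^sub>R a N - \<sigma> *\<^sub>R a i))
     = (\<mu> / \<sigma> ^ 3) *\<^sub>R (mat 1 - D_mat N m a \<mu>)"
    by simp
  have "kepler_r p e \<theta> / \<sigma> * (\<mu> / \<sigma> ^ 3) = (1 / (1 + e * cos \<theta>)) * (\<mu> * p / \<sigma> ^ 4)"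
    by (simp add: kepler_r_def eval_nat_numeral mult_ac)
  also have "\<dots> = 1 / (1 + e * cos \<theta>)"
    using \<sigma> p \<mu> by simp
  finally have "kepler_r p e \<theta> / \<sigma> * (\<mu> / \<sigma> ^ 3) = 1 / (1 + e * cos \<theta>)" .
  \<comment> \<open>No bound on \<open>e\<close> is assumed here: if the denominator vanishes, both
    sides are 0 by the convention for division.\<close>
  moreover have "kepler_r p e \<theta> / p = 1 / (1 + e * cos \<theta>)"
    using p by (simp add: kepler_r_def)
  ultimately show ?thesis
    unfolding T scaleR_scaleR by (simp add: algebra_simps)
qed

text \<open>The momentum block cancels by the form of \<open>ere\<close>. In the position block
  \<open>J2\<close> squared gives \<open>- \<sigma>\<close>, the quadratic term
  \<open>(1 - r / p) * \<sigma>\<close> and the force \<open>(r / p) * \<sigma>\<close>, all times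
  \<open>a N\<close>.\<close>

lemma grad_H_red_ere:
  assumes p: "p > 0" and \<mu>: "\<mu> > 0" and \<sigma>: "\<sigma> > 0" "\<sigma> ^ 4 = \<mu> * p"
    and cc: "(\<Sum>i\<in>{1..N-1}. (m i / (norm (a i - a N)) ^ 3) *\<^sub>R (a i - a N)) = - \<mu> *\<^sub>R a N"
  shows "grad_H_red N m a \<sigma> p e \<theta> (ere \<sigma> (a N)) = 0"
proof -
  \<comment> \<open>The force is odd and homogeneous of degree -2; the sign reverses the difference
    to match \<open>cc\<close>.\<close>
  have "(m i / norm (\<sigma> *\<^sub>R a N - \<sigma> *\<^sub>R a i) ^ 3) *\<^sub>R (\<sigma> *\<^sub>R a N - \<sigma> *\<^sub>R a i)
      = (- 1 / \<sigma>\<^sup>2) *\<^sub>R ((m i / (norm (a i - a N)) ^ 3) *\<^sub>R (a i - a N))" for i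
  proof -
    have "norm (\<sigma> *\<^sub>R a N - \<sigma> *\<^sub>R a i) = \<sigma> * norm (a i - a N)"
      using \<sigma>(1) by (metis abs_of_pos norm_minus_commute norm_scaleR scaleR_diff_right)
    then show ?thesis
      using \<sigma>(1) by (simp add: power_mult_distrib vec_eq_iff field_simps eval_nat_numeral)
  qed
  then have "(\<Sum>i\<in>{1..N-1}. (m i / norm (\<sigma> *\<^sub>R a N - \<sigma> *\<^sub>R a i) ^ 3) *\<^sub>R (\<sigma> *\<^sub>R a N - \<sigma> *\<^sub>R a i))
      = (- 1 / \<sigma>\<^sup>2) *\<^sub>R (- \<mu> *\<^sub>R a N)"
    by (simp only: cc flip: scaleR_sum_right)
  then have F: "(\<Sum>i\<in>{1..N-1}. (m i / norm (\<sigma> *\<^sub>R a N - \<sigma> *\<^sub>R a i) ^ 3) *\<^sub>R (\<sigma> *\<^sub>R a N - \<sigma> *\<^sub>R a i))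
      = (\<mu> / \<sigma>\<^sup>2) *\<^sub>R a N"
    by simp
  have "kepler_r p e \<theta> / \<sigma> * (\<mu> / \<sigma>\<^sup>2) = kepler_r p e \<theta> * (\<mu> * \<sigma>) / \<sigma> ^ 4"
    using \<sigma>(1) by (simp add: eval_nat_numeral)
  also have "\<dots> = kepler_r p e \<theta> / p * \<sigma>"
    using \<sigma>(2) \<mu> p by simp
  finally have k: "kepler_r p e \<theta> / \<sigma> * (\<mu> / \<sigma>\<^sup>2) = kepler_r p e \<theta> / p * \<sigma>" .
  have J: "J2 *v (J2 *v x) = - x" for x
    by (simp add: J2_mult vec_eq_iff forall_2)
  have "join 0 0 = 0"
    by (simp add: join_def vec_eq_iff split: sum.split)
  then show ?thesis
    unfolding grad_H_red_def ere_def block_mult_join pos_join F scaleR_scaleR k join_add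
    by (simp add: matrix_vector_mult_minus_left matrix_vector_mult_scaleR J scaleR_diff_left
        matrix_vector_mult_diff_rdistrib scaleR_diff_right mult.commute
        flip: scaleR_matrix_vector_assoc)
qed

text \<open>With at most one primary the central configuration equations are contradictory: for \<open>N \<le> 1\<close>
  the normalization fails, and for \<open>N = 2\<close> the empty sum gives \<open>\<mu> = 0\<close>, so no force acts on \<open>a 2\<close>.\<close>

lemma cc_mu_pos:
  assumes masses: "\<forall>i\<in>{1..N-1}. m i > 0" and cc: "normalized_restricted_cc N m a \<mu>"
  shows "N \<ge> 3" "\<mu> > 0"
proof -
  have inj: "inj_on a {1..N}" and norm1: "(\<Sum>i\<in>{1..N-1}. m i * (norm (a i))\<^sup>2) = 1"
    and mu: "\<mu> = (\<Sum>(i, j)\<in>{(i, j). 1 \<le> i \<and> i < j \<and> j \<le> N - 1}. m i * m j / norm (a i - a j))"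
    and eq: "\<And>i. i \<in> {1..N} \<Longrightarrow> 
        (\<Sum>j\<in>{1..N-1} - {i}. (m j / (norm (a j - a i)) ^ 3) *\<^sub>R (a j - a i)) = - \<mu> *\<^sub>R a i"
    using cc unfolding normalized_restricted_cc_def by auto
  have "\<not> N \<le> 1"
    using norm1 by auto
  moreover have "N \<noteq> 2"
  proof
    assume N: "N = 2"
    then have e: "{(i, j). 1 \<le> i \<and> i < j \<and> j \<le> N - 1} = {}"
      by auto
    have "\<mu> = 0"
      using mu unfolding e by simp
    moreover have "{1..N-1} - {2} = {1::nat}"
      using N by auto
    ultimately have "(m 1 / (norm (a 1 - a 2)) ^ 3) *\<^sub>R (a 1 - a 2) = 0"
      using eq [of 2] N by simp
    moreover have "a 1 \<noteq> a 2"
      using inj_onD [OF inj, of 1 2] N by auto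
    ultimately show False
      using masses N by auto
  qed
  ultimately show N: "N \<ge> 3"
    by linarith
  let ?P = "{(i, j). 1 \<le> i \<and> i < j \<and> j \<le> N - 1}"
  have "finite ?P"
    by (rule finite_subset [of _ "{1..N} \<times> {1..N}"]) auto
  moreover have "?P \<noteq> {}"
  proof -
    \<comment> \<open>At least two primaries exist, so the sum of positive terms defining
      \<open>\<mu>\<close> is nonempty.\<close>
    have "(1, 2) \<in> ?P"
      using N by simp
    then show ?thesis
      by blast
  qed
  moreover have "m i * m j / norm (a i - a j) > 0" if "(i, j) \<in> ?P" for i j
  proof -
    have "a i \<noteq> a j"
      using inj that by (force dest: inj_onD)
    then show ?thesis
      using masses that by simp
  qed
  ultimately show "\<mu> > 0"
    unfolding mu by (intro sum_pos) auto
qed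

section \<open>The rotating frame and the reduced coordinates\<close>

lemma rot_inverse: "rot (- \<theta>) *v (rot \<theta> *v x) = x"
proof -
  have c: "cos \<theta> * (cos \<theta> * u) + sin \<theta> * (sin \<theta> * u) = u" for u
    using sin_cos_squared_add3 [of \<theta>] by (metis add.commute distrib_right mult.assoc mult_1)
  have s: "sin \<theta> * (sin \<theta> * u) + cos \<theta> * (cos \<theta> * u) = u" for u
    using c [of u] by simp
  then show ?thesis
    by (simp add: rot_def matrix_vector_mult_def vec_eq_iff forall_2 sum_2 distrib_left
        right_diff_distrib mult.left_commute c s)
qed

text \<open>Planar rotations commute, and \<open>J2\<close> is the rotation by a right
  angle.\<close>

lemma rot_J2: "rot \<theta> *v (J2 *v x) = J2 *v (rot \<theta> *v x)"
  by (simp add: rot_def J2_def matrix_vector_mult_def vec_eq_iff forall_2 sum_2)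

text \<open>A rotation is \<open>cos\<close> times the identity plus \<open>sin\<close> times
  \<open>J2\<close>; as \<open>J2\<close> squares to minus the identity, differentiating in the
  angle multiplies by \<open>J2\<close>.\<close>

lemma rot_has_vector_derivative:
  assumes "(\<phi> has_real_derivative w) (at t)"
  shows "((\<lambda>s. rot (\<phi> s) *v c) has_vector_derivative w *\<^sub>R (J2 *v (rot (\<phi> t) *v c))) (at t)"
proof -
  have "((\<lambda>s. cos (\<phi> s) *\<^sub>R c + sin (\<phi> s) *\<^sub>R (J2 *v c)) has_vector_derivative
     (- sin (\<phi> t) * w) *\<^sub>R c + (cos (\<phi> t) * w) *\<^sub>R (J2 *v c)) (at t)"
    using assms by (auto intro!: derivative_eq_intros)
  moreover have "rot x *v c = cos x *\<^sub>R c + sin x *\<^sub>R (J2 *v c)" for x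
    by (simp add: rot_def J2_def matrix_vector_mult_def vec_eq_iff forall_2 sum_2)
  moreover have "w *\<^sub>R (J2 *v (cos x *\<^sub>R c + sin x *\<^sub>R (J2 *v c)))
      = (- sin x * w) *\<^sub>R c + (cos x * w) *\<^sub>R (J2 *v c)" for x
    by (simp add: J2_mult vec_eq_iff forall_2 algebra_simps)
  ultimately show ?thesis
    by simp
qed

text \<open>The velocity has a tangential part of size \<open>\<sigma>\<^sup>2 / r\<close> and a
  radial part \<open>r'\<close>. The momentum formula subtracts exactly the radial part and rescales
  the tangential one to \<open>\<sigma>\<close>.\<close>

lemma reduced_coords_ere:
  assumes r: "kepler_r p e (\<phi> t) \<noteq> 0" and \<sigma>: "\<sigma> \<noteq> 0"
    and \<phi>: "(\<phi> has_real_derivative \<sigma>\<^sup>2 / (kepler_r p e (\<phi> t))\<^sup>2) (at t)"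
    and r': "((\<lambda>s. kepler_r p e (\<phi> s)) has_real_derivative r') (at t)"
    and P: "((\<lambda>s. kepler_r p e (\<phi> s) *\<^sub>R (rot (\<phi> s) *v c)) has_vector_derivative P) (at t)"
  shows "reduced_coords \<sigma> (kepler_r p e (\<phi> t)) r' (\<phi> t) P
          (kepler_r p e (\<phi> t) *\<^sub>R (rot (\<phi> t) *v c)) = ere \<sigma> c"
proof -
  let ?r = "kepler_r p e (\<phi> t)"
  have "((\<lambda>s. kepler_r p e (\<phi> s) *\<^sub>R (rot (\<phi> s) *v c)) has_vector_derivative
      ?r *\<^sub>R ((\<sigma>\<^sup>2 / ?r\<^sup>2) *\<^sub>R (J2 *v (rot (\<phi> t) *v c))) + r' *\<^sub>R (rot (\<phi> t) *v c)) (at t)"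
    by (intro has_vector_derivative_scaleR r' rot_has_vector_derivative \<phi>)
  then have "P = ?r *\<^sub>R ((\<sigma>\<^sup>2 / ?r\<^sup>2) *\<^sub>R (J2 *v (rot (\<phi> t) *v c))) + r' *\<^sub>R (rot (\<phi> t) *v c)"
    using P vector_derivative_unique_at by blast
  then have "rot (- \<phi> t) *v P = (\<sigma>\<^sup>2 / ?r) *\<^sub>R (J2 *v c) + r' *\<^sub>R c"
    using r by (simp add: matrix_vector_right_distrib matrix_vector_mult_scaleR rot_inverse power2_eq_square
        flip: rot_J2)
  then show ?thesis
    using r \<sigma> by (simp add: reduced_coords_def ere_def join_eq_iff matrix_vector_mult_scaleR rot_inverse
        scaleR_add_right power2_eq_square)
qed

lemma kepler_r_pos:
  assumes "0 \<le> e" "e < 1" "p > 0"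
  shows "kepler_r p e \<theta> > 0"
proof -
  have "\<bar>e * cos \<theta>\<bar> \<le> e * 1"
    unfolding abs_mult using assms by (intro mult_mono) auto
  then have "1 + e * cos \<theta> > 0"
    using assms by linarith
  then show ?thesis
    using assms by (simp add: kepler_r_def)
qed

lemma ere_eq_iff:
  assumes "\<sigma> \<noteq> 0"
  shows "ere \<sigma> c = join (vector [0, \<sigma>]) (vector [\<sigma>, 0]) \<longleftrightarrow> c = vector [1, 0]"
  using assms unfolding ere_def join_eq_iff by (auto simp: J2_mult vec_eq_iff forall_2)

section \<open>The quadratic Hamiltonian and its linear system\<close>

lemma transpose_B_mat: "transpose (B_mat N m a \<mu> e \<theta>) = B_mat N m a \<mu> e \<theta>"
proof -
  have "transpose (D_mat N m a \<mu>) = D_mat N m a \<mu>"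
    by (simp add: D_mat_def transpose_def vec_eq_iff mat_def outer_def mult_ac)
  then show ?thesis
    unfolding B_mat_def
    by (intro transpose_block_J2) (simp add: transpose_def vec_eq_iff mat_def)
qed

lemma H2_eq: "H2 N m a \<mu> e \<theta> Z z = (join Z z \<bullet> (B_mat N m a \<mu> e \<theta> *v join Z z)) / 2"
  by (simp add: B_mat_def block_J2_form H2_def)

text \<open>The gradient of a symmetric form is linear, so the field of \<open>H2\<close> is linear
  on all of phase space.\<close>

lemma ham_field_H2: "ham_field (H2 N m a \<mu> e) \<theta> \<xi> ((J4 ** B_mat N m a \<mu> e \<theta>) *v \<xi>)"
proof -
  have "GDERIV (\<lambda>\<eta>. H2 N m a \<mu> e \<theta> (mom \<eta>) (pos \<eta>)) \<xi> :> B_mat N m a \<mu> e \<theta> *v \<xi>"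
    unfolding H2_eq join_mom_pos by (intro GDERIV_quadratic_form transpose_B_mat)
  from ham_field_of_GDERIV [where H = "H2 N m a \<mu> e", OF this] show ?thesis
    by (simp add: matrix_vector_mul_assoc)
qed

theorem theorem1p1:
  fixes N :: nat and m :: "nat \<Rightarrow> real" and a :: "nat \<Rightarrow> real^2"
    and \<mu> e p \<sigma> :: real and \<xi>0 :: phase
  assumes masses: "\<forall>i\<in>{1..N-1}. m i > 0" and massless: "m N = 0"
    and cc: "normalized_restricted_cc N m a \<mu>"
    and ecc: "0 \<le> e" "e < 1" and p: "p > 0" and \<sigma>: "\<sigma> = (\<mu> * p) powr (1/4)"
    and \<xi>0: "\<xi>0 = ere \<sigma> (a N)"
  shows "(\<forall>\<phi> t r' P.
        (\<phi> has_real_derivative \<sigma>\<^sup>2 / (kepler_r p e (\<phi> t))\<^sup>2) (at t) \<longrightarrow>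
        ((\<lambda>s. kepler_r p e (\<phi> s)) has_real_derivative r') (at t) \<longrightarrow>
        ((\<lambda>s. kepler_r p e (\<phi> s) *\<^sub>R (rot (\<phi> s) *v a N)) has_vector_derivative P) (at t) \<longrightarrow>
        reduced_coords \<sigma> (kepler_r p e (\<phi> t)) r' (\<phi> t) P
          (kepler_r p e (\<phi> t) *\<^sub>R (rot (\<phi> t) *v a N)) = \<xi>0) \<and>
     (\<xi>0 = join (vector [0, \<sigma>]) (vector [\<sigma>, 0]) \<longleftrightarrow> a N = vector [1, 0]) \<and>
     (\<forall>\<theta>. solves_ham_at (H_red N m a \<sigma> p e) (\<lambda>_. \<xi>0) \<theta>) \<and>
     (\<forall>\<theta>. has_hessian (\<lambda>\<eta>. H_red N m a \<sigma> p e \<theta> (mom \<eta>) (pos \<eta>)) \<xi>0 (B_mat N m a \<mu> e \<theta>)) \<and>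
     (\<forall>\<theta>. ham_linearization (H_red N m a \<sigma> p e) \<theta> \<xi>0 (J4 ** B_mat N m a \<mu> e \<theta>)) \<and>
     (\<forall>\<xi> \<theta>. solves_linearized_at (H_red N m a \<sigma> p e) (\<lambda>_. \<xi>0) \<xi> \<theta> \<longleftrightarrow>
        (\<xi> has_vector_derivative (J4 ** B_mat N m a \<mu> e \<theta>) *v \<xi> \<theta>) (at \<theta>)) \<and>
     (\<forall>\<theta> Z z. H2 N m a \<mu> e \<theta> Z z = (join Z z \<bullet> (B_mat N m a \<mu> e \<theta> *v join Z z)) / 2) \<and>
     (\<forall>\<xi> \<theta>. solves_ham_at (H2 N m a \<mu> e) \<xi> \<theta> \<longleftrightarrow>
        solves_linearized_at (H_red N m a \<sigma> p e) (\<lambda>_. \<xi>0) \<xi> \<theta>)"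
proof -
  have inj: "inj_on a {1..N}" and eq: "\<And>i. i \<in> {1..N} \<Longrightarrow>
      (\<Sum>j\<in>{1..N-1} - {i}. (m j / (norm (a j - a i)) ^ 3) *\<^sub>R (a j - a i)) = - \<mu> *\<^sub>R a i"
    using cc unfolding normalized_restricted_cc_def by auto
  have N: "N \<ge> 3" and \<mu>: "\<mu> > 0"
    using cc_mu_pos [OF masses cc] by auto
  \<comment> \<open>Positivity of \<open>\<mu> * p\<close> makes \<open>powr\<close> a genuine
    fourth root.\<close>
  have \<sigma>0: "\<sigma> > 0" and \<sigma>4: "\<sigma> ^ 4 = \<mu> * p"
    using \<sigma> \<mu> p by (simp_all add: powr_power)
  \<comment> \<open>The massless body is not among the primaries, so its equation sums over all of
    them.\<close>
  have "{1..N-1} - {N} = {1..N-1}"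
    using N by auto
  then have ccN: "(\<Sum>i\<in>{1..N-1}. (m i / (norm (a i - a N)) ^ 3) *\<^sub>R (a i - a N)) = - \<mu> *\<^sub>R a N"
    using eq [of N] N by simp
  have free: "pos \<xi>0 \<noteq> \<sigma> *\<^sub>R a i" if "i \<in> {1..N-1}" for i
  proof -
    have "i \<noteq> N" "i \<in> {1..N}"
      using that by auto
    then show ?thesis
      using inj_onD [OF inj, of N i] N \<sigma>0 by (auto simp: \<xi>0 ere_def)
  qed
  have hess: "has_hessian (\<lambda>\<eta>. H_red N m a \<sigma> p e \<theta> (mom \<eta>) (pos \<eta>)) \<xi>0 (B_mat N m a \<mu> e \<theta>)" for \<theta>
    using has_hessian_H_red [where \<eta> = \<xi>0 and p = p and N = N and \<sigma> = \<sigma> and a = a, OF _ free]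
      hessian_block_eq [OF p \<mu> \<sigma>0 \<sigma>4] p
    by (simp add: B_mat_def \<xi>0 ere_def)
  note lin = ham_linearization_of_hessian [of "H_red N m a \<sigma> p e", OF hess]
  have lin_iff: "solves_linearized_at (H_red N m a \<sigma> p e) (\<lambda>_. \<xi>0) \<xi> \<theta> \<longleftrightarrow>
      (\<xi> has_vector_derivative (J4 ** B_mat N m a \<mu> e \<theta>) *v \<xi> \<theta>) (at \<theta>)" for \<xi> \<theta>
    using lin by (rule solves_linearized_at_iff)
  \<comment> \<open>The gradient vanishes at \<open>\<xi>0\<close> for every
    \<open>\<theta>\<close>, so the constant curve is a solution although \<open>H_red\<close>
    depends on \<open>\<theta>\<close>.\<close>
  have "ham_field (H_red N m a \<sigma> p e) \<theta> \<xi>0 0" for \<theta>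
    using ham_field_of_GDERIV [of "H_red N m a \<sigma> p e", OF GDERIV_H_red [OF _ free]] p
      grad_H_red_ere [OF p \<mu> \<sigma>0 \<sigma>4 ccN] by (simp add: \<xi>0)
  then have equilibrium: "solves_ham_at (H_red N m a \<sigma> p e) (\<lambda>_. \<xi>0) \<theta>" for \<theta>
    using solves_ham_at_iff [where \<xi> = "\<lambda>_. \<xi>0" and V = 0] by simp
  have "reduced_coords \<sigma> (kepler_r p e (\<phi> t)) r' (\<phi> t) P
          (kepler_r p e (\<phi> t) *\<^sub>R (rot (\<phi> t) *v a N)) = \<xi>0"
    if "(\<phi> has_real_derivative \<sigma>\<^sup>2 / (kepler_r p e (\<phi> t))\<^sup>2) (at t)"
      "((\<lambda>s. kepler_r p e (\<phi> s)) has_real_derivative r') (at t)"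
      "((\<lambda>s. kepler_r p e (\<phi> s) *\<^sub>R (rot (\<phi> s) *v a N)) has_vector_derivative P) (at t)"
    for \<phi> t r' P
    unfolding \<xi>0
    using reduced_coords_ere [OF _ _ that] kepler_r_pos [OF ecc p, of "\<phi> t"] \<sigma>0 by simp
  moreover have "\<xi>0 = join (vector [0, \<sigma>]) (vector [\<sigma>, 0]) \<longleftrightarrow> a N = vector [1, 0]"
    using ere_eq_iff \<sigma>0 by (simp add: \<xi>0)
  ultimately show ?thesis
    \<comment> \<open>For the last clause, both systems reduce to the same linear equation with
      matrix \<open>J4 ** B_mat N m a \<mu> e \<theta>\<close>.\<close>
    using equilibrium hess lin lin_iff H2_eq solves_ham_at_iff [OF ham_field_H2]
    by (intro conjI allI impI) simp_all
qed

end
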